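(* Let all weights equal one, $\mathbf w_M=\mathbf 1_M=(1,\dots,1)$, with $u=1$, and suppose that (A4), (A5) and (A6) of the context hold. Then for any fixed $\lambda\in(0,1)$ (with $\lambda_M=\lambda$ for all $M$) and any $0<\alpha\le a_0$: (C1) $\lim_{M\to\infty}FDP_M(\hat t_{\alpha,M}^0\mathbf 1_M)\le\lim_{M\to\infty}FDP_M(\hat t_{\alpha,M}^\lambda\mathbf 1_M)$ almost surely; (C2) $\lim_{M\to\infty}FDP_M(\hat t_{\alpha,M}^\lambda\mathbf 1_M)\le\alpha$ almost surely; (C3) the inequality in (C2) is an equality almost surely under a Dirac Uniform (DU) distribution.
   Context: For each $M$ one tests null hypotheses $H_m$, $m\in\mathcal M=\{1,\dots,M\}$; $\mathcal M_0\subseteq\mathcal M$ indexes the true nulls, $M_0=|\mathcal M_0|$. Decision functions $\delta_m(t)=\delta_m(Z_m;t)\in\{0,1\}$ based on test statistics $Z_m$ satisfy the NS assumptions: for each $m$, $t\mapsto\delta_m(Z_m;t)$, $t\in[0,1]$, is almost surely nondecreasing and right continuous with $\delta_m=0$ at $t=0$ and $\delta_m=1$ at $t=1$; $t\mapsto E[\delta_m(Z_m;t)]$ is continuous and strictly increasing on $(0,1)$; and $E[\delta_m(Z_m;t)]=t$ for $m\in\mathcal M_0$. $R(t\mathbf 1_M)=\sum_{m\in\mathcal M}\delta_m(t)$, $V(t\mathbf 1_M)=\sum_{m\in\mathcal M_0}\delta_m(t)$, $FDP_M(t\mathbf 1_M)=V(t\mathbf 1_M)/\max\{R(t\mathbf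 1_M),1\}$, $\hat M_0(\lambda\mathbf 1_M)=[M-R(\lambda\mathbf 1_M)+1]/[1-\lambda]$, $$\hat t_{\alpha,M}^0=\sup\Big\{0\le t\le u:\frac{Mt}{\max\{R(t\mathbf 1_M),1\}}\le\alpha\Big\},\quad \hat t_{\alpha,M}^\lambda=\sup\Big\{0\le t\le u:\frac{\hat M_0(\lambda\mathbf 1_M)t}{\max\{R(t\mathbf 1_M),1\}}\le\alpha\Big\}.$$ Assumptions, with $u=1$: (A4) for $t\in(0,u]$, $R(t\mathbf 1_M)/M\to G(t)$ almost surely. (A5) for $t\in(0,u]$, $V(t\mathbf 1_M)/M\to a_0\mu_0t$ almost surely, with $0<a_0<1$, where $M_0/M\to a_0$ (almost surely) and $\mu_0$ is the limit of the mean weight of the true nulls (so $\mu_0=1$ here). (A6) $t/G(t)$ is strictly increasing and continuous on $(0,u)$, with $\lim_{t\downarrow0}t/G(t)=0$ and $\lim_{t\uparrow u}t/G(t)=u/G(u)\le1$. A DU distribution is any distribution of the data with, for $t\in(0,1]$, $E[\delta_m(t)]=t$ if $m\in\mathcal M_0$ and $E[\delta_m(t)]=1$ otherwise (for $m\notin\mathcal M_0$ the strict monotonicity in the NS assumptions is then not required). *)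

theory Defs
  imports "HOL-Probability.Probability"
begin

text \<open>
  For the problem with \<open>M\<close> hypotheses, \<open>\<delta> M m z t\<close> is the decision on hypothesis \<open>m \<in> {1..M}\<close>
  at threshold \<open>t\<close> when its test statistic equals \<open>z\<close>, and \<open>Z M m\<close> is that test statistic.
  Statistics, decision functions and the set \<open>nulls M\<close> of true nulls may all change with \<open>M\<close>
  (a triangular array); a single sequence of hypotheses is the special case without dependence
  on \<open>M\<close>. All problems live on one probability space, so that almost sure limits make sense.
\<close>

definition testing_model ::
  "'a measure \<Rightarrow> 'z measure \<Rightarrow> (nat \<Rightarrow> nat set) \<Rightarrow> (nat \<Rightarrow> nat \<Rightarrow> 'a \<Rightarrow> 'z) \<Rightarrow>
     (nat \<Rightarrow> nat \<Rightarrow> 'z \<Rightarrow> real \<Rightarrow> real) \<Rightarrow> bool" where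
  "testing_model P N nulls Z \<delta> \<longleftrightarrow>
     prob_space P \<and>
     (\<forall>M. nulls M \<subseteq> {1..M}) \<and>
     (\<forall>M. \<forall>m\<in>{1..M}. Z M m \<in> measurable P N \<and>
        (\<forall>t\<in>{0..1}. (\<lambda>z. \<delta> M m z t) \<in> borel_measurable N \<and> (\<forall>z\<in>space N. \<delta> M m z t \<in> {0, 1})))"

definition decision ::
  "(nat \<Rightarrow> nat \<Rightarrow> 'a \<Rightarrow> 'z) \<Rightarrow> (nat \<Rightarrow> nat \<Rightarrow> 'z \<Rightarrow> real \<Rightarrow> real) \<Rightarrow>
     nat \<Rightarrow> 'a \<Rightarrow> nat \<Rightarrow> real \<Rightarrow> real" where
  "decision Z \<delta> M \<omega> m t = \<delta> M m (Z M m \<omega>) t"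

text \<open>
  The next definitions are pathwise: \<open>d m t\<close> is the realised decision on hypothesis \<open>m\<close> at the
  common threshold \<open>t\<close> (all weights are one).
\<close>

definition rejections :: "(nat \<Rightarrow> real \<Rightarrow> real) \<Rightarrow> nat \<Rightarrow> real \<Rightarrow> real" where
  "rejections d M t = (\<Sum>m\<in>{1..M}. d m t)"

definition false_rejections :: "(nat \<Rightarrow> real \<Rightarrow> real) \<Rightarrow> nat set \<Rightarrow> real \<Rightarrow> real" where
  "false_rejections d H t = (\<Sum>m\<in>H. d m t)"

definition FDP :: "(nat \<Rightarrow> real \<Rightarrow> real) \<Rightarrow> nat set \<Rightarrow> nat \<Rightarrow> real \<Rightarrow> real" where
  "FDP d H M t = false_rejections d H t / max (rejections d M t) 1"

definition M0_hat :: "(nat \<Rightarrow> real \<Rightarrow> real) \<Rightarrow> nat \<Rightarrow> real \<Rightarrow> real" where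
  "M0_hat d M l = (real M - rejections d M l + 1) / (1 - l)"

definition t_hat_0 :: "(nat \<Rightarrow> real \<Rightarrow> real) \<Rightarrow> nat \<Rightarrow> real \<Rightarrow> real" where
  "t_hat_0 d M \<alpha> = Sup {t. 0 \<le> t \<and> t \<le> 1 \<and> real M * t / max (rejections d M t) 1 \<le> \<alpha>}"

definition t_hat_adaptive :: "(nat \<Rightarrow> real \<Rightarrow> real) \<Rightarrow> nat \<Rightarrow> real \<Rightarrow> real \<Rightarrow> real" where
  "t_hat_adaptive d M l \<alpha> =
     Sup {t. 0 \<le> t \<and> t \<le> 1 \<and> M0_hat d M l * t / max (rejections d M t) 1 \<le> \<alpha>}"

definition power_fun :: "'a measure \<Rightarrow> (nat \<Rightarrow> 'a \<Rightarrow> nat \<Rightarrow> real \<Rightarrow> real) \<Rightarrow> nat \<Rightarrow> nat \<Rightarrow> real \<Rightarrow> real" where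
  "power_fun P D M m t = (\<integral>\<omega>. D M \<omega> m t \<partial>P)"

text \<open>
  In the relaxed form, right continuity at \<open>0\<close> and strict monotonicity of \<open>power_fun\<close> are not
  required. Both must be dropped for false nulls to admit Dirac Uniform distributions: there
  a false null has \<open>\<delta>(t) = 1\<close> almost surely for every \<open>t > 0\<close>, whereas \<open>\<delta>(0) = 0\<close>. For true nulls
  nothing is lost, since both properties follow from \<open>power_fun P D M m t = t\<close> and monotonicity.
\<close>

definition NS_relaxed ::
  "'a measure \<Rightarrow> (nat \<Rightarrow> nat set) \<Rightarrow> (nat \<Rightarrow> 'a \<Rightarrow> nat \<Rightarrow> real \<Rightarrow> real) \<Rightarrow> bool" where
  "NS_relaxed P nulls D \<longleftrightarrow>
     (\<forall>M. \<forall>m\<in>{1..M}.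
        (AE \<omega> in P. mono_on {0..1} (D M \<omega> m) \<and>
           (\<forall>t\<in>{0<..1}. continuous (at t within {t..1}) (D M \<omega> m)) \<and>
           D M \<omega> m 0 = 0 \<and> D M \<omega> m 1 = 1) \<and>
        continuous_on {0<..<1} (power_fun P D M m) \<and>
        (m \<in> nulls M \<longrightarrow> (\<forall>t\<in>{0..1}. power_fun P D M m t = t)))"

definition NS ::
  "'a measure \<Rightarrow> (nat \<Rightarrow> nat set) \<Rightarrow> (nat \<Rightarrow> 'a \<Rightarrow> nat \<Rightarrow> real \<Rightarrow> real) \<Rightarrow> bool" where
  "NS P nulls D \<longleftrightarrow>
     NS_relaxed P nulls D \<and>
     (\<forall>M. \<forall>m\<in>{1..M}.
        (AE \<omega> in P. continuous (at 0 within {0..1}) (D M \<omega> m)) \<and>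
        strict_mono_on {0<..<1} (power_fun P D M m))"

definition Dirac_Uniform ::
  "'a measure \<Rightarrow> (nat \<Rightarrow> nat set) \<Rightarrow> (nat \<Rightarrow> 'a \<Rightarrow> nat \<Rightarrow> real \<Rightarrow> real) \<Rightarrow> bool" where
  "Dirac_Uniform P nulls D \<longleftrightarrow>
     (\<forall>M. \<forall>m\<in>{1..M}. \<forall>t\<in>{0<..1}. power_fun P D M m t = (if m \<in> nulls M then t else 1))"

definition A4 :: "'a measure \<Rightarrow> (nat \<Rightarrow> 'a \<Rightarrow> nat \<Rightarrow> real \<Rightarrow> real) \<Rightarrow> (real \<Rightarrow> real) \<Rightarrow> bool" where
  "A4 P D G \<longleftrightarrow>
     (\<forall>t\<in>{0<..1}. AE \<omega> in P. (\<lambda>M. rejections (D M \<omega>) M t / real M) \<longlonglongrightarrow> G t)"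

text \<open>With unit weights the limiting mean weight of the true nulls is \<open>1\<close>.\<close>

definition A5 ::
  "'a measure \<Rightarrow> (nat \<Rightarrow> nat set) \<Rightarrow> (nat \<Rightarrow> 'a \<Rightarrow> nat \<Rightarrow> real \<Rightarrow> real) \<Rightarrow> real \<Rightarrow> bool" where
  "A5 P nulls D a0 \<longleftrightarrow>
     0 < a0 \<and> a0 < 1 \<and>
     (\<lambda>M. real (card (nulls M)) / real M) \<longlonglongrightarrow> a0 \<and>
     (\<forall>t\<in>{0<..1}. AE \<omega> in P. (\<lambda>M. false_rejections (D M \<omega>) (nulls M) t / real M) \<longlonglongrightarrow> a0 * t)"

text \<open>
  Positivity of \<open>G\<close> on \<open>(0,1)\<close> need not be assumed: a strictly increasing function with limit \<open>0\<close>
  at \<open>0\<close> is positive, which rules out \<open>G t = 0\<close> since then \<open>t / G t = 0\<close>.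
\<close>

definition A6 :: "(real \<Rightarrow> real) \<Rightarrow> bool" where
  "A6 G \<longleftrightarrow>
     strict_mono_on {0<..<1} (\<lambda>t. t / G t) \<and>
     continuous_on {0<..<1} (\<lambda>t. t / G t) \<and>
     ((\<lambda>t. t / G t) \<longlongrightarrow> 0) (at_right 0) \<and>
     ((\<lambda>t. t / G t) \<longlongrightarrow> 1 / G 1) (at_left 1) \<and>
     1 / G 1 \<le> 1"

end

theory Submission
  imports Defs
begin

text \<open>
  Along almost every path the normalised counts are monotone in the threshold and converge at all
  rational thresholds, hence, the limits \<open>G t\<close> and \<open>a0 * t\<close> being continuous, they converge along
  every convergent sequence of thresholds. If \<open>c\<close> is the limit of the estimate of the number of
  true nulls divided by \<open>M\<close>, the data-driven threshold therefore tends to the solution \<open>\<tau>\<close> of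
  \<open>\<tau> / G \<tau> = \<alpha> / c\<close>, and the FDP tends to \<open>a0 * \<tau> / G \<tau> = a0 * \<alpha> / c\<close>. Here \<open>c = 1\<close> for the
  unadaptive and \<open>c = (1 - G l) / (1 - l)\<close> for the adaptive threshold; the latter lies between \<open>a0\<close>
  and \<open>1\<close>, and equals \<open>a0\<close> in the Dirac Uniform case, where \<open>G l = a0 * l + 1 - a0\<close>.
\<close>

text \<open>A squeeze between two fixed thresholds: eventually \<open>x n\<close> lies between
  rationals close to \<open>y\<close>, monotonicity carries this over to \<open>g n (x n)\<close>,
  and continuity of \<open>G\<close> makes both limits close to \<open>G y\<close>. Asking for
  convergence at rationals only keeps the exceptional null sets countable in number.\<close>

lemma monotone_tendsto_diag:
  fixes g :: "nat \<Rightarrow> real \<Rightarrow> real"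
  assumes mono: "\<And>n. mono_on {0..1} (g n)"
    and lim: "\<And>t. t \<in> \<rat> \<Longrightarrow> 0 < t \<Longrightarrow> t \<le> 1 \<Longrightarrow> (\<lambda>n. g n t) \<longlonglongrightarrow> G t"
    and cont: "continuous_on {0<..1} G"
    and x: "x \<longlonglongrightarrow> y" "0 < y" "y \<le> 1" "\<And>n. x n \<in> {0..1}"
  shows "(\<lambda>n. g n (x n)) \<longlonglongrightarrow> G y"
proof (rule tendstoI)
  fix e :: real assume "0 < e"
  then obtain d where d: "d > 0"
    "\<And>z. z \<in> {0<..1} \<Longrightarrow> \<bar>z - y\<bar> < d \<Longrightarrow> \<bar>G z - G y\<bar> < e / 2"
    using cont x(2,3) unfolding continuous_on_iff dist_real_def
    by (metis greaterThanAtMost_iff half_gt_zero)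
  obtain a where a: "a \<in> \<rat>" "max 0 (y - d) < a" "a < y"
    using Rats_dense_in_real[of "max 0 (y - d)" y] d(1) x(2) by auto
  \<comment> \<open>At \<open>y = 1\<close> no threshold further right is available;
    \<open>b = 1\<close> itself serves, as all \<open>x n\<close> are at most 1.\<close>
  obtain b where b: "b \<in> \<rat>" "y \<le> b" "b \<le> 1" "b < y + d" "b = 1 \<or> y < b"
  proof (cases "y = 1")
    case True
    then show ?thesis using that[of 1] d(1) by auto
  next
    case False
    then show ?thesis
      using Rats_dense_in_real[of y "min 1 (y + d)"] that d(1) x(3) by force
  qed
  have "\<forall>\<^sub>F n in sequentially. a < x n" using order_tendstoD(1)[OF x(1)] a(3) .
  moreover have "\<forall>\<^sub>F n in sequentially. x n \<le> b"
    using b(5)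
  proof
    assume "b = 1" then show ?thesis using x(4) by auto
  next
    assume "y < b"
    then have "\<forall>\<^sub>F n in sequentially. x n < b" by (rule order_tendstoD(2)[OF x(1)])
    then show ?thesis by eventually_elim simp
  qed
  moreover have "\<forall>\<^sub>F n in sequentially. G a - e / 2 < g n a"
    using order_tendstoD(1)[OF lim[of a]] a b x \<open>0 < e\<close> by auto
  moreover have "\<forall>\<^sub>F n in sequentially. g n b < G b + e / 2"
    using order_tendstoD(2)[OF lim[of b]] a b x \<open>0 < e\<close> by auto
  ultimately show "\<forall>\<^sub>F n in sequentially. dist (g n (x n)) (G y) < e"
  proof eventually_elim
    case (elim n)
    have "g n a \<le> g n (x n)"
      by (rule mono_onD[OF mono]) (use elim a x(3) x(4)[of n] in auto)
    moreover have "g n (x n) \<le> g n b"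
      by (rule mono_onD[OF mono]) (use elim b x(2) x(4)[of n] in auto)
    moreover have "\<bar>G a - G y\<bar> < e / 2" "\<bar>G b - G y\<bar> < e / 2"
      using d(2)[of a] d(2)[of b] a b x(2,3) by auto
    ultimately show ?case using elim unfolding dist_real_def by linarith
  qed
qed

text \<open>Below \<open>\<tau>\<close>, convergence at a single point bounds the supremum from
  below. The set need not be an interval, so the upper bound requires excluding all \<open>t\<close>
  in \<open>{b..1}\<close> at once, for some \<open>b\<close> above \<open>\<tau>\<close>;
  compactness of that interval provides this.\<close>

lemma threshold_tendsto:
  fixes g :: "nat \<Rightarrow> real \<Rightarrow> real"
  assumes mono: "\<And>n. mono_on {0..1} (g n)"
    and lim: "\<And>t. 0 < t \<Longrightarrow> t \<le> 1 \<Longrightarrow> (\<lambda>n. g n t) \<longlonglongrightarrow> G t"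
    and cont: "continuous_on {0<..1} G"
    and pos: "\<And>t. 0 < t \<Longrightarrow> t \<le> 1 \<Longrightarrow> 0 < G t"
    and c: "cn \<longlonglongrightarrow> c" and "0 < \<alpha>"
    and tau: "0 < \<tau>" "\<tau> \<le> 1"
    and below: "\<And>t. 0 < t \<Longrightarrow> t < \<tau> \<Longrightarrow> c * t / G t < \<alpha>"
    and above: "\<And>t. \<tau> < t \<Longrightarrow> t \<le> 1 \<Longrightarrow> \<alpha> < c * t / G t"
  shows "(\<lambda>n. Sup {t. 0 \<le> t \<and> t \<le> 1 \<and> cn n * t / g n t \<le> \<alpha>}) \<longlonglongrightarrow> \<tau>"
    (is "?T \<longlonglongrightarrow> \<tau>")
proof (rule order_tendstoI)
  fix a assume "a < \<tau>"
  then obtain t where t: "max 0 a < t" "t < \<tau>" using dense[of "max 0 a" \<tau>] tau by auto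
  have "(\<lambda>n. cn n * t / g n t) \<longlonglongrightarrow> c * t / G t"
    by (intro tendsto_intros c lim) (use t tau pos[of t] in auto)
  then have "\<forall>\<^sub>F n in sequentially. cn n * t / g n t < \<alpha>"
    by (rule order_tendstoD(2)) (use t below in auto)
  then show "\<forall>\<^sub>F n in sequentially. a < ?T n"
  proof eventually_elim
    case (elim n)
    have "t \<le> ?T n"
      by (rule cSup_upper) (use t tau elim in \<open>auto intro!: bdd_aboveI[of _ 1]\<close>)
    then show ?case using t by auto
  qed
next
  fix a assume a: "\<tau> < a"
  show "\<forall>\<^sub>F n in sequentially. ?T n < a"
  proof (cases "a \<le> 1")
    case False
    have "?T n \<le> 1" for n
      by (rule cSup_least) (use \<open>0 < \<alpha>\<close> in \<open>auto intro!: exI[of _ 0]\<close>)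
    then show ?thesis using False by (intro always_eventually allI) (meson le_less_trans not_le)
  next
    case True
    obtain b where b: "\<tau> < b" "b < a" using dense[OF a] by blast
    define S where "S = {0..1::real}" \<comment> \<open>hides the bound \<open>1\<close>, which the induction would generalise\<close>
    \<comment> \<open>The inequality is multiplied out so that zeros of \<open>g n\<close> do no
      harm. Bisection reduces the uniform claim to short intervals around each point
      \<open>s\<close>.\<close>
    have "\<forall>\<^sub>F n in sequentially. \<forall>t\<in>{b..1} \<inter> S. \<alpha> * g n t < cn n * t"
      using less_imp_le[OF less_le_trans[OF b(2) True]]
    proof (induction rule: Bolzano)
      case (trans r s t)
      from trans(1,2) show ?case by eventually_elim (meson Int_iff atLeastAtMost_iff linear)
    next
      case (local s)
      have s: "0 < s" "s \<le> 1" using local b tau by auto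
      have ineq: "\<alpha> * G s < c * s"
        using above[of s] local b s pos[of s] by (auto simp: field_simps)
      \<comment> \<open>A third of the gap at \<open>s\<close>: one third pays for the variation of
        \<open>G\<close>, one for moving from \<open>c * s\<close> to \<open>c * r\<close>, and one
        remains.\<close>
      define h where "h = (c * s - \<alpha> * G s) / 3"
      have h: "0 < h" using ineq by (simp add: h_def)
      obtain d1 where d1: "d1 > 0"
        "\<And>z. z \<in> {0<..1} \<Longrightarrow> \<bar>z - s\<bar> < d1 \<Longrightarrow> \<bar>G z - G s\<bar> < h / \<alpha>"
        using cont s h \<open>0 < \<alpha>\<close> unfolding continuous_on_iff dist_real_def
        by (metis greaterThanAtMost_iff divide_pos_pos)
      \<comment> \<open>The three bounds control \<open>G\<close> near \<open>s\<close>, keep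
        \<open>r\<close> positive and give \<open>\<bar>c\<bar> * d < h\<close>; the added 1 avoids
        a zero denominator while the sign of \<open>c\<close> is open.\<close>
      define d where "d = Min {d1, s, h / (\<bar>c\<bar> + 1)}"
      have d: "0 < d" "d \<le> d1" "d \<le> s" "d \<le> h / (\<bar>c\<bar> + 1)"
        using d1 s h by (auto simp: d_def)
      have "\<forall>\<^sub>F n in sequentially. \<forall>t\<in>{r..t} \<inter> S. \<alpha> * g n t < cn n * t"
        if rt: "r \<le> s" "s \<le> t" "t - r < d" for r t
      proof -
        have r: "0 < r" "r \<le> 1" using rt d s by auto
        \<comment> \<open>The interval may extend past 1, where nothing is known about
          \<open>g\<close>. Comparing \<open>g n\<close> at the right end with
          \<open>cn n * r\<close> at the left end settles all points in between, by monotonicity of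
          both sides.\<close>
        define t' where "t' = min t 1"
        have t': "0 < t'" "t' \<le> 1" "\<bar>t' - s\<bar> < d1" using rt d s by (auto simp: t'_def)
        have "\<alpha> * G t' < \<alpha> * G s + h"
        proof -
          have "G t' < G s + h / \<alpha>" using d1(2)[of t'] t' by auto
          then show ?thesis using \<open>0 < \<alpha>\<close> by (simp add: field_simps)
        qed
        moreover have "c * s - h < c * r"
        proof -
          have "c * (s - r) \<le> \<bar>c\<bar> * (s - r)" using rt by (intro mult_right_mono) auto
          also have "\<dots> \<le> \<bar>c\<bar> * d" using rt by (intro mult_left_mono) auto
          also have "\<dots> < (\<bar>c\<bar> + 1) * d" using d by (simp add: algebra_simps)
          also have "\<dots> \<le> h" using d(4) by (simp add: field_simps add_pos_nonneg)
          finally show ?thesis by (simp add: algebra_simps)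
        qed
        ultimately have "\<alpha> * G t' < c * r" using h unfolding h_def by argo
        moreover have "(\<lambda>n. cn n * r - \<alpha> * g n t') \<longlonglongrightarrow> c * r - \<alpha> * G t'"
          by (intro tendsto_intros c lim t')
        ultimately have "\<forall>\<^sub>F n in sequentially. 0 < cn n * r - \<alpha> * g n t'"
          by (intro order_tendstoD(1)) auto
        moreover have "0 < c"
          using above[of s] local b s pos[of s] \<open>0 < \<alpha>\<close>
          by (smt (verit) divide_nonpos_pos mult_nonpos_nonneg)
        then have "\<forall>\<^sub>F n in sequentially. 0 < cn n" using order_tendstoD(1)[OF c] by auto
        ultimately show ?thesis
        proof eventually_elim
          case (elim n)
          show ?case
          proof
            fix z assume "z \<in> {r..t} \<inter> S"
            then have z: "z \<in> {r..t} \<inter> {0..1}" by (simp add: S_def)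
            have "\<alpha> * g n z \<le> \<alpha> * g n t'"
              using z t' \<open>0 < \<alpha>\<close> by (intro mult_left_mono mono_onD[OF mono]) (auto simp: t'_def)
            also have "\<dots> < cn n * r" using elim by simp
            also have "\<dots> \<le> cn n * z" using z elim by (intro mult_left_mono) auto
            finally show "\<alpha> * g n z < cn n * z" .
          qed
        qed
      qed
      with d(1) show ?case by blast
    qed
    \<comment> \<open>As division by zero yields 0, a \<open>t\<close> with \<open>g n t = 0\<close>
      would belong to the set. Positivity at \<open>b\<close> spreads to all larger thresholds by
      monotonicity and rules this out.\<close>
    moreover have "\<forall>\<^sub>F n in sequentially. 0 < g n b"
      using order_tendstoD(1)[OF lim[of b]] pos[of b] b tau True by auto
    ultimately show ?thesis
    proof eventually_elim
      case (elim n)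
      have "?T n \<le> b"
      proof (rule cSup_least)
        show "{t. 0 \<le> t \<and> t \<le> 1 \<and> cn n * t / g n t \<le> \<alpha>} \<noteq> {}"
          using \<open>0 < \<alpha>\<close> by (auto intro!: exI[of _ 0])
      next
        fix t assume t: "t \<in> {t. 0 \<le> t \<and> t \<le> 1 \<and> cn n * t / g n t \<le> \<alpha>}"
        show "t \<le> b"
        proof (rule ccontr)
          assume "\<not> t \<le> b"
          then have "g n b \<le> g n t"
            using t b tau by (intro mono_onD[OF mono]) auto
          then have "0 < g n t" using elim by simp
          then show False
            using t elim(1) \<open>\<not> t \<le> b\<close> by (auto simp: S_def field_simps dest!: bspec[of _ _ t])
        qed
      qed
      then show ?case using b by simp
    qed
  qed
qed

text \<open>Under \<open>G 1 = 1\<close> the left limit of \<open>t / G t\<close> at 1 is its value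
  there, so monotonicity and continuity extend from the open interval to \<open>{0<..1}\<close>. The
  quotient then increases from 0 to 1, which gives positivity of \<open>G\<close>, its continuity by
  inverting the quotient, and solutions by the intermediate value theorem.\<close>

lemma A6_props:
  assumes "A6 G" and G1: "G 1 = 1"
  shows A6_pos: "\<And>t. 0 < t \<Longrightarrow> t \<le> 1 \<Longrightarrow> 0 < G t"
    and A6_strict: "strict_mono_on {0<..1} (\<lambda>t. t / G t)"
    and A6_cont: "continuous_on {0<..1} G"
    and A6_solution: "\<And>\<beta>. 0 < \<beta> \<Longrightarrow> \<beta> \<le> 1 \<Longrightarrow> \<exists>t. 0 < t \<and> t \<le> 1 \<and> t / G t = \<beta>"
proof -
  define Q where "Q = (\<lambda>t. t / G t)"
  have Q: "strict_mono_on {0<..<1} Q" "continuous_on {0<..<1} Q"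
    "(Q \<longlongrightarrow> 0) (at_right 0)" "(Q \<longlongrightarrow> 1) (at_left 1)" "Q 1 = 1"
    using assms by (auto simp: A6_def Q_def)
  have Qle: "Q r \<le> Q s" if "0 < r" "r < s" "s < 1" for r s
    using strict_mono_onD[OF Q(1), of r s] that by simp
  \<comment> \<open>The limit at 0 gives only \<open>0 \<le> Q s\<close>; strictness comes from
    comparing \<open>t\<close> with \<open>t / 2\<close>. The bound by 1 arises in the same way at
    the other end, with a point \<open>s\<close> between \<open>t\<close> and 1.\<close>
  have Qpos: "0 < Q t" if "0 < t" "t < 1" for t
  proof -
    have "0 \<le> Q s" if "0 < s" "s < 1" for s
    proof (rule tendsto_upperbound[OF Q(3)])
      show "\<forall>\<^sub>F r in at_right 0. Q r \<le> Q s"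
        unfolding eventually_at_right[OF \<open>0 < s\<close>]
        using that Qle by (intro exI[of _ s]) auto
    qed simp
    then have "0 \<le> Q (t / 2)" using that by auto
    also have "\<dots> < Q t" by (rule strict_mono_onD[OF Q(1)]) (use that in auto)
    finally show ?thesis .
  qed
  have Qlt1: "Q t < 1" if "0 < t" "t < 1" for t
  proof -
    obtain s where s: "t < s" "s < 1" using dense[OF \<open>t < 1\<close>] by blast
    have "Q s \<le> 1"
    proof (rule tendsto_lowerbound[OF Q(4)])
      show "\<forall>\<^sub>F r in at_left 1. Q s \<le> Q r"
        unfolding eventually_at_left[OF \<open>s < 1\<close>]
        using that s Qle by (intro exI[of _ s]) auto
    qed simp
    moreover have "Q t < Q s" by (rule strict_mono_onD[OF Q(1)]) (use that s in auto)
    ultimately show ?thesis by simp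
  qed
  show pos: "0 < G t" if "0 < t" "t \<le> 1" for t
    using Qpos[of t] that G1 by (cases "t = 1") (auto simp: Q_def zero_less_divide_iff)
  show "strict_mono_on {0<..1} (\<lambda>t. t / G t)"
    unfolding Q_def[symmetric]
  proof (rule strict_mono_onI)
    fix r s :: real assume "r \<in> {0<..1}" "s \<in> {0<..1}" "r < s"
    then show "Q r < Q s"
      using Qlt1[of r] Q(5) strict_mono_onD[OF Q(1), of r s] by (cases "s = 1") auto
  qed
  have contQ: "continuous_on {0<..1} Q"
    unfolding continuous_on_def
  proof
    fix t :: real assume t: "t \<in> {0<..1}"
    show "(Q \<longlongrightarrow> Q t) (at t within {0<..1})"
    proof (cases "t = 1")
      case True
      have "(Q \<longlongrightarrow> Q 1) (at 1 within {0<..1})"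
        unfolding Q(5)
        by (rule tendsto_mono[OF _ Q(4)]) (auto simp: at_within_def intro!: le_infI2)
      then show ?thesis using True by simp
    next
      case False
      have "isCont Q t"
        using continuous_on_interior[OF Q(2)] t False by auto
      then show ?thesis by (auto simp: isCont_def intro: tendsto_within_subset)
    qed
  qed
  have "continuous_on {0<..1} (\<lambda>t. t / Q t)"
    by (intro continuous_intros contQ) (use Qpos Q(5) in \<open>force simp: le_less\<close>)
  then show "continuous_on {0<..1} G"
    by (rule continuous_on_eq) (use pos in \<open>force simp: Q_def\<close>)
  show "\<exists>t. 0 < t \<and> t \<le> 1 \<and> t / G t = \<beta>" if "0 < \<beta>" "\<beta> \<le> 1" for \<beta>
  proof -
    have "\<forall>\<^sub>F r in at_right 0. Q r < \<beta>" using order_tendstoD(2)[OF Q(3) that(1)] .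
    moreover have "\<forall>\<^sub>F r in at_right 0. 0 < r \<and> r < (1::real)"
      unfolding eventually_at_right[OF zero_less_one] by (intro exI[of _ 1]) auto
    ultimately have "\<forall>\<^sub>F r in at_right 0. Q r < \<beta> \<and> 0 < r \<and> r < (1::real)"
      by eventually_elim auto
    then obtain r where r: "Q r < \<beta>" "0 < r" "r < 1"
      using eventually_happens'[OF trivial_limit_at_right_real] by blast
    have "\<exists>x\<ge>r. x \<le> 1 \<and> Q x = \<beta>"
      by (rule IVT') (use r that Q(5) in \<open>auto intro: continuous_on_subset[OF contQ]\<close>)
    then show ?thesis using r less_le_trans unfolding Q_def by blast
  qed
qed

text \<open>This concerns one path and serves both thresholds: \<open>C M\<close> is the number of
  true nulls used in the threshold, \<open>real M\<close> or its estimate \<open>M0_hat\<close>.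
  Numerator and denominator of the FDP, divided by \<open>M\<close>, converge along the random
  thresholds, so their quotient does.\<close>

lemma FDP_tendsto:
  fixes d :: "nat \<Rightarrow> nat \<Rightarrow> real \<Rightarrow> real"
  assumes "A6 G" "G 1 = 1"
    and nulls: "\<And>M. nulls M \<subseteq> {1..M}"
    and mono: "\<And>M m. m \<in> {1..M} \<Longrightarrow> mono_on {0..1} (d M m)"
    and R: "\<And>t. t \<in> \<rat> \<Longrightarrow> 0 < t \<Longrightarrow> t \<le> 1 \<Longrightarrow> (\<lambda>M. rejections (d M) M t / real M) \<longlonglongrightarrow> G t"
    and V: "\<And>t. t \<in> \<rat> \<Longrightarrow> 0 < t \<Longrightarrow> t \<le> 1 \<Longrightarrow>
       (\<lambda>M. false_rejections (d M) (nulls M) t / real M) \<longlonglongrightarrow> a0 * t"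
    and C: "(\<lambda>M. C M / real M) \<longlonglongrightarrow> c" and "0 < \<alpha>" "\<alpha> \<le> c"
  shows "(\<lambda>M. FDP (d M) (nulls M) M
           (Sup {t. 0 \<le> t \<and> t \<le> 1 \<and> C M * t / max (rejections (d M) M t) 1 \<le> \<alpha>})) \<longlonglongrightarrow> a0 * \<alpha> / c"
    (is "(\<lambda>M. FDP _ _ _ (?T M)) \<longlonglongrightarrow> _")
proof -
  note G = A6_props[OF assms(1,2)]
  have "0 < c" using assms by simp
  \<comment> \<open>The floor 1 is kept inside \<open>g\<close>, so that \<open>M\<close> cancels
    exactly; after division it is \<open>1 / real M\<close> and vanishes in the limit.\<close>
  define g where "g = (\<lambda>M t. max (rejections (d M) M t) 1 / real M)"
  define v where "v = (\<lambda>M t. false_rejections (d M) (nulls M) t / real M)"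
  have g_mono: "mono_on {0..1} (g M)" for M
    unfolding g_def rejections_def
    by (intro mono_onI divide_right_mono max.mono sum_mono mono_onD[OF mono]) auto
  have v_mono: "mono_on {0..1} (v M)" for M
    unfolding v_def false_rejections_def
    by (intro mono_onI divide_right_mono sum_mono mono_onD[OF mono]) (use nulls in \<open>blast | simp\<close>)+
  have g_lim: "(\<lambda>M. g M t) \<longlonglongrightarrow> G t" if "t \<in> \<rat>" "0 < t" "t \<le> 1" for t
  proof -
    have "(\<lambda>M. max (rejections (d M) M t / real M) (1 / real M)) \<longlonglongrightarrow> max (G t) 0"
      by (intro tendsto_max R that lim_1_over_n)
    then show ?thesis
      using G(1)[of t] that by (simp add: g_def max_divide_distrib_right)
  qed
  \<comment> \<open>Here \<open>\<alpha> \<le> c\<close> matters: it puts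
    \<open>\<alpha> / c\<close> into the range of \<open>t / G t\<close>.\<close>
  obtain \<tau> where tau: "0 < \<tau>" "\<tau> \<le> 1" "\<tau> / G \<tau> = \<alpha> / c"
    using G(4)[of "\<alpha> / c"] assms \<open>0 < c\<close> by auto
  have cmp: "c * s / G s < c * t / G t" if "0 < s" "s < t" "t \<le> 1" for s t
    using strict_mono_onD[OF G(2), of s t] that \<open>0 < c\<close>
      mult_strict_left_mono[of "s / G s" "t / G t" c] by auto
  have ctau: "c * \<tau> / G \<tau> = \<alpha>"
    using tau(3) \<open>0 < c\<close> by (metis nonzero_mult_div_cancel_left less_irrefl times_divide_eq_right)
  have "(\<lambda>M. Sup {t. 0 \<le> t \<and> t \<le> 1 \<and> C M / real M * t / g M t \<le> \<alpha>}) \<longlonglongrightarrow> \<tau>"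
  proof (rule threshold_tendsto[OF g_mono _ G(3) G(1) C \<open>0 < \<alpha>\<close> tau(1,2)])
    show "(\<lambda>M. g M t) \<longlonglongrightarrow> G t" if "0 < t" "t \<le> 1" for t
      by (rule monotone_tendsto_diag[OF g_mono g_lim G(3) tendsto_const]) (use that in auto)
  qed (use cmp ctau tau in force)+
  moreover have "\<forall>\<^sub>F M in sequentially.
      Sup {t. 0 \<le> t \<and> t \<le> 1 \<and> C M / real M * t / g M t \<le> \<alpha>} = ?T M"
    using eventually_gt_at_top[of 0]
  proof eventually_elim
    case (elim M)
    then have "C M / real M * t / g M t = C M * t / max (rejections (d M) M t) 1" for t
      by (simp add: g_def)
    then show ?case by presburger
  qed
  ultimately have T: "?T \<longlonglongrightarrow> \<tau>" by (rule Lim_transform_eventually)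
  have T01: "?T M \<in> {0..1}" for M
  proof -
    let ?A = "{t. 0 \<le> t \<and> t \<le> 1 \<and> C M * t / max (rejections (d M) M t) 1 \<le> \<alpha>}"
    have "0 \<in> ?A" using \<open>0 < \<alpha>\<close> by simp
    moreover have "bdd_above ?A" by (auto intro!: bdd_aboveI[of _ 1])
    ultimately show ?thesis
      by (auto intro!: cSup_upper cSup_least)
  qed
  have "(\<lambda>M. v M (?T M) / g M (?T M)) \<longlonglongrightarrow> a0 * \<tau> / G \<tau>"
  proof (intro tendsto_divide)
    show "(\<lambda>M. g M (?T M)) \<longlonglongrightarrow> G \<tau>"
      by (rule monotone_tendsto_diag[OF g_mono g_lim G(3) T tau(1,2) T01])
    show "(\<lambda>M. v M (?T M)) \<longlonglongrightarrow> a0 * \<tau>"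
      by (rule monotone_tendsto_diag[OF v_mono _ _ T tau(1,2) T01])
        (use V in \<open>auto simp: v_def intro!: continuous_intros\<close>)
    show "G \<tau> \<noteq> 0" using G(1)[OF tau(1,2)] by simp
  qed
  moreover have "a0 * \<tau> / G \<tau> = a0 * \<alpha> / c" using tau(3) by (metis times_divide_eq_right)
  ultimately have "(\<lambda>M. v M (?T M) / g M (?T M)) \<longlonglongrightarrow> a0 * \<alpha> / c" by simp
  moreover have "\<forall>\<^sub>F M in sequentially.
      v M (?T M) / g M (?T M) = FDP (d M) (nulls M) M (?T M)"
    using eventually_gt_at_top[of 0]
    by eventually_elim (simp add: v_def g_def FDP_def)
  ultimately show ?thesis by (rule Lim_transform_eventually)
qed

theorem corollary1:
  fixes P :: "'a measure" and N :: "'z measure"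
    and nulls :: "nat \<Rightarrow> nat set"
    and Z :: "nat \<Rightarrow> nat \<Rightarrow> 'a \<Rightarrow> 'z"
    and \<delta> :: "nat \<Rightarrow> nat \<Rightarrow> 'z \<Rightarrow> real \<Rightarrow> real"
    and D :: "nat \<Rightarrow> 'a \<Rightarrow> nat \<Rightarrow> real \<Rightarrow> real"
    and G :: "real \<Rightarrow> real"
    and a0 l \<alpha> :: real
  assumes "testing_model P N nulls Z \<delta>"
    and "D = decision Z \<delta>"
    and "NS P nulls D \<or> (NS_relaxed P nulls D \<and> Dirac_Uniform P nulls D)"
    and "A4 P D G" and "A5 P nulls D a0" and "A6 G"
    and "0 < l" and "l < 1"
    and "0 < \<alpha>" and "\<alpha> \<le> a0"
  shows "(AE \<omega> in P.
            convergent (\<lambda>M. FDP (D M \<omega>) (nulls M) M (t_hat_0 (D M \<omega>) M \<alpha>)) \<and>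
            convergent (\<lambda>M. FDP (D M \<omega>) (nulls M) M (t_hat_adaptive (D M \<omega>) M l \<alpha>)) \<and>
            lim (\<lambda>M. FDP (D M \<omega>) (nulls M) M (t_hat_0 (D M \<omega>) M \<alpha>))
              \<le> lim (\<lambda>M. FDP (D M \<omega>) (nulls M) M (t_hat_adaptive (D M \<omega>) M l \<alpha>))) \<and>
         (AE \<omega> in P.
            convergent (\<lambda>M. FDP (D M \<omega>) (nulls M) M (t_hat_adaptive (D M \<omega>) M l \<alpha>)) \<and>
            lim (\<lambda>M. FDP (D M \<omega>) (nulls M) M (t_hat_adaptive (D M \<omega>) M l \<alpha>)) \<le> \<alpha>) \<and>
         (Dirac_Uniform P nulls D \<longrightarrow>
            (AE \<omega> in P.
               convergent (\<lambda>M. FDP (D M \<omega>) (nulls M) M (t_hat_adaptive (D M \<omega>) M l \<alpha>)) \<and>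
               lim (\<lambda>M. FDP (D M \<omega>) (nulls M) M (t_hat_adaptive (D M \<omega>) M l \<alpha>)) = \<alpha>))"
proof -
  define p where "p = (1 - G l) / (1 - l)"
  interpret prob_space P using assms(1) by (simp add: testing_model_def)
  have nulls: "nulls M \<subseteq> {1..M}" for M using assms(1) by (simp add: testing_model_def)
  have NS: "NS_relaxed P nulls D" using assms(3) by (auto simp: NS_def)
  have a0: "0 < a0" "a0 < 1" "(\<lambda>M. real (card (nulls M)) / real M) \<longlonglongrightarrow> a0"
    using assms(5) by (auto simp: A5_def)
  have mono: "AE \<omega> in P. \<forall>M. \<forall>m\<in>{1..M}. mono_on {0..1} (D M \<omega> m) \<and> D M \<omega> m 1 = 1"
    unfolding AE_all_countable
  proof
    fix M
    show "AE \<omega> in P. \<forall>m\<in>{1..M}. mono_on {0..1} (D M \<omega> m) \<and> D M \<omega> m 1 = 1"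
      by (rule AE_finite_allI) (use NS in \<open>auto simp: NS_relaxed_def\<close>)
  qed
  \<comment> \<open>Each threshold has its own null set, and only countably many can be united. The
    point \<open>l\<close> is added to the rationals because the limit of \<open>M0_hat\<close> is
    read off there.\<close>
  have RV: "AE \<omega> in P. \<forall>t \<in> {t. (t \<in> \<rat> \<or> t = l) \<and> 0 < t \<and> t \<le> 1}.
      (\<lambda>M. rejections (D M \<omega>) M t / real M) \<longlonglongrightarrow> G t \<and>
      (\<lambda>M. false_rejections (D M \<omega>) (nulls M) t / real M) \<longlonglongrightarrow> a0 * t"
  proof (rule AE_ball_countable')
    have "{t. (t \<in> \<rat> \<or> t = l) \<and> 0 < t \<and> t \<le> 1} \<subseteq> insert l \<rat>" by auto
    then show "countable {t. (t \<in> \<rat> \<or> t = l) \<and> 0 < t \<and> t \<le> 1}"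
      by (rule countable_subset) (simp add: countable_rat)
  qed (use assms(4,5) in \<open>auto simp: A4_def A5_def\<close>)
  define good where "good = (\<lambda>\<omega>. (\<forall>M. \<forall>m\<in>{1..M}. mono_on {0..1} (D M \<omega> m) \<and> D M \<omega> m 1 = 1) \<and>
      (\<forall>t \<in> {t. (t \<in> \<rat> \<or> t = l) \<and> 0 < t \<and> t \<le> 1}.
      (\<lambda>M. rejections (D M \<omega>) M t / real M) \<longlonglongrightarrow> G t \<and>
      (\<lambda>M. false_rejections (D M \<omega>) (nulls M) t / real M) \<longlonglongrightarrow> a0 * t))"
  have good: "AE \<omega> in P. good \<omega>" using mono RV unfolding good_def by eventually_elim simp
  have good_R: "(\<lambda>M. rejections (D M \<omega>) M t / real M) \<longlonglongrightarrow> G t"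
    and good_V: "(\<lambda>M. false_rejections (D M \<omega>) (nulls M) t / real M) \<longlonglongrightarrow> a0 * t"
    if "good \<omega>" "t \<in> \<rat> \<or> t = l" "0 < t" "t \<le> 1" for \<omega> t
    using that unfolding good_def by blast+
  have good_mono: "mono_on {0..1} (D M \<omega> m)" and good_1: "D M \<omega> m 1 = 1"
    if "good \<omega>" "m \<in> {1..M}" for \<omega> M m
    using that unfolding good_def by blast+
  \<comment> \<open>The facts about \<open>G\<close> and \<open>p\<close> below are deterministic,
    so a single good path proves them.\<close>
  obtain \<omega>0 where w0: "good \<omega>0"
    using eventually_happens'[OF ae_filter_bot good] by blast
  \<comment> \<open>At threshold 1 every hypothesis is rejected.\<close>
  have G1: "G 1 = 1"
  proof -
    have "(\<lambda>M. rejections (D M \<omega>0) M 1 / real M) \<longlonglongrightarrow> G 1" using good_R[OF w0] by simp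
    moreover have "(\<lambda>M. rejections (D M \<omega>0) M 1 / real M) \<longlonglongrightarrow> 1"
    proof (rule tendsto_eventually)
      show "\<forall>\<^sub>F M in sequentially. rejections (D M \<omega>0) M 1 / real M = 1"
        using eventually_gt_at_top[of 0]
        by eventually_elim (use good_1[OF w0] in \<open>simp add: rejections_def\<close>)
    qed
    ultimately show ?thesis by (rule LIMSEQ_unique)
  qed
  \<comment> \<open>The strictly increasing quotient \<open>t / G t\<close> equals 1 at 1, so
    \<open>l < G l\<close>.\<close>
  have "p \<le> 1"
  proof -
    have "l / G l < 1"
      using strict_mono_onD[OF A6_strict[OF assms(6) G1], of l 1] assms(7,8) G1 by simp
    then show ?thesis
      using A6_pos[OF assms(6) G1, of l] assms(7,8) by (simp add: p_def field_simps)
  qed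
  \<comment> \<open>The true nulls rejected between \<open>l\<close> and 1 are among all hypotheses
    rejected there; divided by \<open>M\<close> this becomes
    \<open>a0 * (1 - l) \<le> 1 - G l\<close>.\<close>
  have "a0 \<le> p"
  proof -
    have "a0 * 1 - a0 * l \<le> G 1 - G l"
    proof (rule LIMSEQ_le)
      show "(\<lambda>M. rejections (D M \<omega>0) M 1 / real M - rejections (D M \<omega>0) M l / real M)
          \<longlonglongrightarrow> G 1 - G l"
        using assms(7,8) by (intro tendsto_diff good_R[OF w0]) auto
      show "(\<lambda>M. false_rejections (D M \<omega>0) (nulls M) 1 / real M
            - false_rejections (D M \<omega>0) (nulls M) l / real M) \<longlonglongrightarrow> a0 * 1 - a0 * l"
        using assms(7,8) by (intro tendsto_diff good_V[OF w0]) auto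
      have "(\<Sum>m\<in>nulls M. D M \<omega>0 m 1 - D M \<omega>0 m l) \<le> (\<Sum>m\<in>{1..M}. D M \<omega>0 m 1 - D M \<omega>0 m l)" for M
      proof (rule sum_mono2)
        fix m assume "m \<in> {1..M} - nulls M"
        then have "mono_on {0..1} (D M \<omega>0 m)" using good_mono[OF w0] by simp
        then have "D M \<omega>0 m l \<le> D M \<omega>0 m 1"
          by (rule mono_onD) (use assms(7,8) in auto)
        then show "0 \<le> D M \<omega>0 m 1 - D M \<omega>0 m l" by simp
      qed (use nulls in auto)
      then show "\<exists>N. \<forall>M\<ge>N. false_rejections (D M \<omega>0) (nulls M) 1 / real M
            - false_rejections (D M \<omega>0) (nulls M) l / real M
          \<le> rejections (D M \<omega>0) M 1 / real M - rejections (D M \<omega>0) M l / real M"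
        by (simp add: rejections_def false_rejections_def sum_subtractf
            diff_divide_distrib[symmetric] divide_right_mono)
    qed
    then show ?thesis using G1 assms(8) by (simp add: p_def field_simps)
  qed
  have lim0: "(\<lambda>M. FDP (D M \<omega>) (nulls M) M (t_hat_0 (D M \<omega>) M \<alpha>)) \<longlonglongrightarrow> a0 * \<alpha>" if "good \<omega>" for \<omega>
  proof -
    have "(\<lambda>M. real M / real M) \<longlonglongrightarrow> 1"
      by (rule tendsto_eventually) (use eventually_gt_at_top[of 0] in eventually_elim, simp)
    then show ?thesis
      using FDP_tendsto[OF assms(6) G1 nulls good_mono[OF that] good_R[OF that] good_V[OF that],
          of real 1 \<alpha>] assms(9,10) a0 by (simp add: t_hat_0_def)
  qed
  have liml: "(\<lambda>M. FDP (D M \<omega>) (nulls M) M (t_hat_adaptive (D M \<omega>) M l \<alpha>)) \<longlonglongrightarrow> a0 * \<alpha> / p"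
    if "good \<omega>" for \<omega>
  proof -
    \<comment> \<open>Writing \<open>real M / real M\<close> for 1 makes the identity with
      \<open>M0_hat\<close> hold at \<open>M = 0\<close> too. The summand 1 in \<open>M0_hat\<close>
      contributes nothing to the limit.\<close>
    have "(\<lambda>M. (real M / real M - rejections (D M \<omega>) M l / real M + 1 / real M) / (1 - l))
        \<longlonglongrightarrow> (1 - G l + 0) / (1 - l)"
    proof (intro tendsto_intros lim_1_over_n)
      show "(\<lambda>M. real M / real M) \<longlonglongrightarrow> 1"
        by (rule tendsto_eventually) (use eventually_gt_at_top[of 0] in eventually_elim, simp)
    qed (use good_R[OF that, of l] assms(7,8) in auto)
    moreover have "(real M / real M - rejections (D M \<omega>) M l / real M + 1 / real M) / (1 - l) =
        M0_hat (D M \<omega>) M l / real M" for M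
      by (simp add: M0_hat_def add_divide_distrib diff_divide_distrib mult.commute)
    ultimately have "(\<lambda>M. M0_hat (D M \<omega>) M l / real M) \<longlonglongrightarrow> p" by (simp add: p_def)
    then show ?thesis
      using FDP_tendsto[OF assms(6) G1 nulls good_mono[OF that] good_R[OF that] good_V[OF that],
          of "\<lambda>M. M0_hat (D M \<omega>) M l" p \<alpha>] assms(9,10) \<open>a0 \<le> p\<close> by (simp add: t_hat_adaptive_def)
  qed
  have DU: "p = a0" if "Dirac_Uniform P nulls D"
  proof -
    \<comment> \<open>A decision with values 0 and 1 and mean 1 is almost surely 1, since
      \<open>1 - D M \<omega> m l\<close> is nonnegative with integral 0.\<close>
    have "AE \<omega> in P. \<forall>M. \<forall>m\<in>{1..M} - nulls M. D M \<omega> m l = 1"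
      unfolding AE_all_countable
    proof
      fix M
      show "AE \<omega> in P. \<forall>m\<in>{1..M} - nulls M. D M \<omega> m l = 1"
      proof (rule AE_finite_allI)
        fix m assume m: "m \<in> {1..M} - nulls M"
        have Z: "Z M m \<in> measurable P N" and
          delta: "(\<lambda>z. \<delta> M m z l) \<in> borel_measurable N" "\<And>z. z \<in> space N \<Longrightarrow> \<delta> M m z l \<in> {0, 1}"
          using assms(1,7,8) m by (auto simp: testing_model_def)
        have meas: "(\<lambda>\<omega>. D M \<omega> m l) \<in> borel_measurable P"
          unfolding assms(2) decision_def using measurable_compose[OF Z delta(1)] .
        have D01: "D M \<omega> m l \<in> {0, 1}" if "\<omega> \<in> space P" for \<omega>
          unfolding assms(2) decision_def using delta(2) measurable_space[OF Z that] .
        have int: "integrable P (\<lambda>\<omega>. D M \<omega> m l)"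
          by (rule integrable_const_bound[of _ 1]) (use D01 meas in \<open>force intro!: AE_I2\<close>)+
        have "(\<integral>\<omega>. 1 - D M \<omega> m l \<partial>P) = 0"
          using that m assms(7,8) int
          by (auto simp: Dirac_Uniform_def power_fun_def prob_space)
        moreover have "AE \<omega> in P. 0 \<le> 1 - D M \<omega> m l" using D01 by (force intro!: AE_I2)
        ultimately have "AE \<omega> in P. 1 - D M \<omega> m l = 0"
          using integral_nonneg_eq_0_iff_AE[of P "\<lambda>\<omega>. 1 - D M \<omega> m l"] int by simp
        then show "AE \<omega> in P. D M \<omega> m l = 1" by eventually_elim simp
      qed simp
    qed
    with good have "AE \<omega> in P. good \<omega> \<and> (\<forall>M. \<forall>m\<in>{1..M} - nulls M. D M \<omega> m l = 1)"
      by eventually_elim simp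
    then obtain \<omega> where w: "good \<omega>" "\<And>M m. m \<in> {1..M} - nulls M \<Longrightarrow> D M \<omega> m l = 1"
      using eventually_happens'[OF ae_filter_bot] by blast
    \<comment> \<open>On this path all false nulls are rejected at \<open>l\<close>, so the
      rejections number \<open>M\<close> minus the true nulls plus the false rejections.\<close>
    have "(\<lambda>M. false_rejections (D M \<omega>) (nulls M) l / real M + real M / real M
        - real (card (nulls M)) / real M) \<longlonglongrightarrow> a0 * l + 1 - a0"
    proof (intro tendsto_intros a0(3))
      show "(\<lambda>M. real M / real M) \<longlonglongrightarrow> 1"
        by (rule tendsto_eventually) (use eventually_gt_at_top[of 0] in eventually_elim, simp)
    qed (use good_V[OF w(1), of l] assms(7,8) in auto)
    moreover have "false_rejections (D M \<omega>) (nulls M) l / real M + real M / real M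
        - real (card (nulls M)) / real M = rejections (D M \<omega>) M l / real M" for M
    proof -
      have "rejections (D M \<omega>) M l =
          (\<Sum>m\<in>{1..M} - nulls M. D M \<omega> m l) + false_rejections (D M \<omega>) (nulls M) l"
        unfolding rejections_def false_rejections_def
        by (rule sum.subset_diff) (use nulls in auto)
      also have "(\<Sum>m\<in>{1..M} - nulls M. D M \<omega> m l) = real (card ({1..M} - nulls M))"
        using w(2) by simp
      also have "\<dots> = real M - real (card (nulls M))"
        using nulls[of M] card_mono[OF _ nulls[of M]]
        by (simp add: card_Diff_subset finite_subset of_nat_diff)
      finally show ?thesis by (simp add: add_divide_distrib diff_divide_distrib)
    qed
    ultimately have "(\<lambda>M. rejections (D M \<omega>) M l / real M) \<longlonglongrightarrow> a0 * l + 1 - a0" by simp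
    moreover have "(\<lambda>M. rejections (D M \<omega>) M l / real M) \<longlonglongrightarrow> G l"
      using good_R[OF w(1), of l] assms(7,8) by simp
    ultimately have "G l = a0 * l + 1 - a0" using LIMSEQ_unique by blast
    then show ?thesis using assms(8) by (simp add: p_def field_simps)
  qed
  have p: "0 < p" using a0 \<open>a0 \<le> p\<close> by simp
  \<comment> \<open>The two limits of the FDP are compared through
    \<open>a0 \<le> p \<le> 1\<close>; \<open>p = a0\<close> turns the second bound into an
    equality.\<close>
  have "a0 * \<alpha> \<le> a0 * \<alpha> / p" "a0 * \<alpha> / p \<le> \<alpha>"
    using p \<open>p \<le> 1\<close> \<open>a0 \<le> p\<close> a0 assms(9)
    by (auto simp: field_simps mult_left_le mult_right_mono)
  then have "AE \<omega> in P.
      convergent (\<lambda>M. FDP (D M \<omega>) (nulls M) M (t_hat_0 (D M \<omega>) M \<alpha>)) \<and>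
      convergent (\<lambda>M. FDP (D M \<omega>) (nulls M) M (t_hat_adaptive (D M \<omega>) M l \<alpha>)) \<and>
      lim (\<lambda>M. FDP (D M \<omega>) (nulls M) M (t_hat_0 (D M \<omega>) M \<alpha>))
        \<le> lim (\<lambda>M. FDP (D M \<omega>) (nulls M) M (t_hat_adaptive (D M \<omega>) M l \<alpha>)) \<and>
      lim (\<lambda>M. FDP (D M \<omega>) (nulls M) M (t_hat_adaptive (D M \<omega>) M l \<alpha>)) \<le> \<alpha> \<and>
      (Dirac_Uniform P nulls D \<longrightarrow>
        lim (\<lambda>M. FDP (D M \<omega>) (nulls M) M (t_hat_adaptive (D M \<omega>) M l \<alpha>)) = \<alpha>)"
    using lim0[THEN convergentI] liml[THEN convergentI] DU a0(1)
    by (intro eventually_mono[OF good]) (auto simp: lim0[THEN limI] liml[THEN limI])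
  then show ?thesis by (auto elim!: eventually_mono)
qed

end
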